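(* Let $p\ge q\ge1$, let $X=\mathbf{R}^{p\times q}$, let $A:X\to\mathbf{R}^m$ be a linear map, $\phi(\cdot)$ a norm on $\mathbf{R}^m$, and $s$ a nonnegative integer. Let $\widehat{\beta}[\cdot]$ be a convex real-valued function on the space of linear maps $H:X\to\mathbf{R}^m$ such that $\widehat{\beta}[H]\ge\beta[H]$ for all $H$. Let $\beta,\gamma\ge 0$ be real parameters. If the system of convex constraints $$\mathrm{Opt}^*[\mathrm{Id}-H^*A]\le\gamma,\qquad\widehat{\beta}[H]\le\beta$$ in the variable $H$ is solvable, then $$\forall z\in\mathbf{R}^{p\times q}:\quad\Sigma_s(z)+\Sigma_{2s}(z)\le\beta\phi(Az)+\gamma\|z\|.$$
   Context: $\mathrm{Id}$ is the identity on $X=\mathbf{R}^{p\times q}$ (equipped with the Frobenius inner product), and $H^*:\mathbf{R}^m\to X$ is the adjoint of $H$. For matrices, $\|\cdot\|$ is the nuclear norm (sum of singular values), $\|\cdot\|_{2,2}$ is the spectral norm (largest singular value), and for $z\in\mathbf{R}^{p\times q}$ with singular values $\sigma_1(z)\ge\dots\ge\sigma_q(z)$, $\Sigma_k(z)=\sum_{i=1}^{\min(k,q)}\sigma_i(z)$ for integers $k\ge0$. Define $$\beta[H]=\max_v\{\Sigma_s(H^*v)+\Sigma_{2s}(H^*v):\ v\in\mathbf{R}^m,\ \phi(v)\le1\}.$$ Matrices $\mathcal{U}\in\mathbf{R}^{pq\times pq}$ are viewed as $q\times p$ block matrices with $p\times q$ blocks $\mathcal{U}^{\mu\nu}$, $1\le\mu\le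 q$, $1\le\nu\le p$. For $h,w\in\mathbf{R}^{p\times q}$, $M[h,w]=h^T\otimes w$ (Kronecker product) has blocks $h_{\nu\mu}w$. For a linear map $W:X\to X$, $\Theta[W]$ is the $pq\times pq$ matrix, linear in $W$, such that $\mathrm{Tr}([Wz]h^T)=\sum_{i,j=1}^{pq}(\Theta[W])_{ij}(h^T\otimes z)_{ij}$ for all $z,h$; explicitly, if $[Wz]_{ij}=\sum_{k,\ell}W_{ijk\ell}z_{k\ell}$, then $(\Theta[W])^{\mu\nu}=[W_{\nu\mu k\ell}]_{1\le k\le p,\,1\le\ell\le q}$. $\mathcal{M}':\mathbf{R}^{pq\times pq}\to\mathbf{R}^{p^2\times q^2}$ is the linear map given by the rearrangement of entries for which $\mathcal{M}'(h^T\otimes w)=h\otimes w$ for all $h,w\in\mathbf{R}^{p\times q}$ (i.e. $\mathcal{M}'(\mathcal{U})$ is the $p\times q$ block matrix whose $(\nu,\mu)$ block is $\mathcal{U}^{\mu\nu}$). $\mathcal{M}'':\mathbf{R}^{pq\times pq}\to\mathbf{R}^{pq\times pq}$ is the linear map given by the permutation of entries for which $\mathcal{M}''(h^T\otimes w)=f(h)g(w)^T$ for all $h,w$, where $f(h)\in\mathbf{R}^{pq}$ is the column vector obtained by stacking the (transposed) rows of $h$ and $g(w)\in\mathbf{R}^{pq}$ is the column vector obtained by stacking the columns of $w$ (i.e. the entry of $\mathcal{M}''(\mathcal{U})$ in row $(\nu-1)q+\mu$ and column $(\ell-1)p+k$ is $(\mathcal{U}^{\mu\nu})_{k\ell}$).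 For an integer $k\ge0$, $$\mathbf{Z}^*_k=\left\{\mathcal{U}\in\mathbf{R}^{pq\times pq}:\ \|\mathcal{U}\|\le k,\ \|\mathcal{U}\|_{2,2}\le1,\ \|\mathcal{M}'(\mathcal{U})\|\le k,\ \|\mathcal{M}'(\mathcal{U})\|_{2,2}\le1,\ \|\mathcal{M}''(\mathcal{U})\|\le\sqrt{k}\right\},$$ and $$\mathrm{Opt}^*[W]=\max_{\mathcal{U},\mathcal{V}}\left\{\sum_{i,j=1}^{pq}(\Theta[W])_{ij}[\mathcal{U}_{ij}+\mathcal{V}_{ij}]:\ \mathcal{U}\in\mathbf{Z}^*_s,\ \mathcal{V}\in\mathbf{Z}^*_{2s}\right\}.$$ *)

theory Defs
  imports "HOL-Analysis.Analysis" "HOL-Computational_Algebra.Polynomial"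
begin

text \<open>A matrix with \<open>p\<close> rows and \<open>q\<close> columns has type \<open>real^'q^'p\<close>; the inner product of this type is
  the Frobenius one. Block matrices have pairs (block index, index inside the block) as row and
  column indices. A matrix in \<open>\<real>^(pq \<times> pq)\<close>, seen as a \<open>q \<times> p\<close> block matrix with \<open>p \<times> q\<close> blocks, thus has
  type \<open>real^('p \<times> 'q)^('q \<times> 'p)\<close>, and entry \<open>(k, l)\<close> of its block \<open>(\<mu>, \<nu>)\<close> is
  \<open>U $ (\<mu>, k) $ (\<nu>, l)\<close>.\<close>

section \<open>Singular values\<close>

definition charpoly_mat :: "real^'n^'n::finite \<Rightarrow> real poly" where
  "charpoly_mat A = det (mat [:0, 1:] - map_matrix (\<lambda>c. [:c:]) A)"

text \<open>Square roots of the eigenvalues of \<open>z\<^sup>T z\<close>, with multiplicity, in decreasing order. There is one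
  for each column of \<open>z\<close>; if \<open>z\<close> has more columns than rows, this adds only zeros.\<close>

definition singular_values :: "real^'n::finite^'m::finite \<Rightarrow> real list" where
  "singular_values z =
     rev (sorted_list_of_multiset (image_mset sqrt (proots (charpoly_mat (transpose z ** z)))))"

text \<open>Numbered from 1, so that \<open>singular_value 1 z\<close> is the largest one.\<close>

definition singular_value :: "nat \<Rightarrow> real^'n::finite^'m::finite \<Rightarrow> real" where
  "singular_value i z = singular_values z ! (i - 1)"

definition Sigma_sum :: "nat \<Rightarrow> real^'n::finite^'m::finite \<Rightarrow> real" where
  "Sigma_sum k z = (\<Sum>i = 1..min k CARD('n). singular_value i z)"

definition nuclear_norm :: "real^'n::finite^'m::finite \<Rightarrow> real" where
  "nuclear_norm z = (\<Sum>i = 1..CARD('n). singular_value i z)"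

definition spectral_norm :: "real^'n::finite^'m::finite \<Rightarrow> real" where
  "spectral_norm z = singular_value 1 z"

section \<open>Norms and the quantity \<open>\<beta>[H]\<close>\<close>

definition is_norm :: "('a::real_vector \<Rightarrow> real) \<Rightarrow> bool" where
  "is_norm \<phi> \<longleftrightarrow>
     (\<forall>x. 0 \<le> \<phi> x) \<and> (\<forall>x. \<phi> x = 0 \<longleftrightarrow> x = 0) \<and>
     (\<forall>c x. \<phi> (c *\<^sub>R x) = \<bar>c\<bar> * \<phi> x) \<and> (\<forall>x y. \<phi> (x + y) \<le> \<phi> x + \<phi> y)"

text \<open>The feasible set is nonempty and compact and the objective is continuous, so the supremum is
  a maximum. The same holds for \<open>Opt_star\<close> below.\<close>

definition beta_of ::
  "(real^'m::finite \<Rightarrow> real) \<Rightarrow> nat \<Rightarrow> (real^'q::finite^'p::finite \<Rightarrow> real^'m) \<Rightarrow> real" where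
  "beta_of \<phi> s H =
     (SUP v\<in>{v. \<phi> v \<le> 1}. Sigma_sum s (adjoint H v) + Sigma_sum (2 * s) (adjoint H v))"

section \<open>Block matrices and the quantity \<open>Opt\<^sup>*[W]\<close>\<close>

definition kronecker ::
  "real^'b::finite^'a::finite \<Rightarrow> real^'d::finite^'c::finite \<Rightarrow> real^('b \<times> 'd)^('a \<times> 'c)" where
  "kronecker A B = (\<chi> r c. A $ fst r $ fst c * B $ snd r $ snd c)"

text \<open>For linear \<open>W\<close>, the number \<open>W (axis k (axis l 1)) $ \<nu> $ \<mu>\<close> is the coefficient \<open>W\<^bsub>\<nu>\<mu>kl\<^esub>\<close> of \<open>W\<close>.\<close>

definition Theta ::
  "(real^'q^'p \<Rightarrow> real^'q^'p) \<Rightarrow> real^('p::finite \<times> 'q::finite)^('q \<times> 'p)" where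
  "Theta W = (\<chi> r c. case (r, c) of ((\<mu>, k), (\<nu>, l)) \<Rightarrow> W (axis k (axis l 1)) $ \<nu> $ \<mu>)"

definition M_prime ::
  "real^('p::finite \<times> 'q::finite)^('q \<times> 'p) \<Rightarrow> real^('q \<times> 'q)^('p \<times> 'p)" where
  "M_prime U = (\<chi> r c. case (r, c) of ((\<nu>, k), (\<mu>, l)) \<Rightarrow> U $ (\<mu>, k) $ (\<nu>, l))"

text \<open>The pairs \<open>(\<nu>, \<mu>)\<close> and \<open>(l, k)\<close>, in lexicographic order, stand for the row number
  \<open>(\<nu> - 1) q + \<mu>\<close> and the column number \<open>(l - 1) p + k\<close>.\<close>

definition M_dprime ::
  "real^('p::finite \<times> 'q::finite)^('q \<times> 'p) \<Rightarrow> real^('q \<times> 'p)^('p \<times> 'q)" where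
  "M_dprime U = (\<chi> r c. case (r, c) of ((\<nu>, \<mu>), (l, k)) \<Rightarrow> U $ (\<mu>, k) $ (\<nu>, l))"

definition Z_star :: "nat \<Rightarrow> (real^('p::finite \<times> 'q::finite)^('q \<times> 'p)) set" where
  "Z_star k = {U.
     nuclear_norm U \<le> real k \<and> spectral_norm U \<le> 1 \<and>
     nuclear_norm (M_prime U) \<le> real k \<and> spectral_norm (M_prime U) \<le> 1 \<and>
     nuclear_norm (M_dprime U) \<le> sqrt (real k)}"

definition Opt_star :: "nat \<Rightarrow> (real^'q::finite^'p::finite \<Rightarrow> real^'q^'p) \<Rightarrow> real" where
  "Opt_star s W =
     (SUP (U, V)\<in>Z_star s \<times> Z_star (2 * s).
        \<Sum>i\<in>UNIV. \<Sum>j\<in>UNIV. Theta W $ i $ j * (U $ i $ j + V $ i $ j))"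

section \<open>Defining properties of the rearrangements\<close>

lemma Theta_trace:
  fixes W :: "real^'q::finite^'p::finite \<Rightarrow> real^'q^'p"
  assumes "linear W"
  shows "trace (W z ** transpose h) =
    (\<Sum>i\<in>UNIV. \<Sum>j\<in>UNIV. Theta W $ i $ j * kronecker (transpose h) z $ i $ j)"
proof -
  have sum_if: "(\<Sum>l\<in>UNIV. if P then f l else 0) = (if P then sum f UNIV else 0)"
    for P and f :: "'q \<Rightarrow> real"
    by simp
  have z: "z = (\<Sum>k\<in>UNIV. \<Sum>l\<in>UNIV. (z $ k $ l) *\<^sub>R axis k (axis l 1))"
    by (simp add: vec_eq_iff axis_def if_distrib[of "\<lambda>x. x $ _"] if_distrib[of "\<lambda>x. _ * x"]
        sum_if cong: if_cong)
  have W: "W z $ \<nu> $ \<mu> = (\<Sum>k\<in>UNIV. \<Sum>l\<in>UNIV. z $ k $ l * W (axis k (axis l 1)) $ \<nu> $ \<mu>)"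
    for \<nu> \<mu>
    by (subst z) (simp add: linear_sum[OF assms] linear_scale[OF assms])
  have "trace (W z ** transpose h) = (\<Sum>\<nu>\<in>UNIV. \<Sum>\<mu>\<in>UNIV. W z $ \<nu> $ \<mu> * h $ \<nu> $ \<mu>)"
    by (simp add: trace_def matrix_matrix_mult_def transpose_def)
  also have "\<dots> = (\<Sum>\<nu>\<in>UNIV. \<Sum>\<mu>\<in>UNIV. \<Sum>k\<in>UNIV. \<Sum>l\<in>UNIV.
      W (axis k (axis l 1)) $ \<nu> $ \<mu> * (h $ \<nu> $ \<mu> * z $ k $ l))"
    by (simp add: W sum_distrib_left mult_ac)
  also have "\<dots> = (\<Sum>\<mu>\<in>UNIV. \<Sum>k\<in>UNIV. \<Sum>\<nu>\<in>UNIV. \<Sum>l\<in>UNIV.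
      W (axis k (axis l 1)) $ \<nu> $ \<mu> * (h $ \<nu> $ \<mu> * z $ k $ l))"
    by (subst sum.swap) (intro sum.cong refl sum.swap)
  finally show ?thesis
    by (simp add: UNIV_Times_UNIV[symmetric] sum.cartesian_product' Theta_def
        kronecker_def transpose_def del: UNIV_Times_UNIV)
qed

lemma M_prime_kronecker: "M_prime (kronecker (transpose h) w) = kronecker h w"
  by (simp add: vec_eq_iff M_prime_def kronecker_def transpose_def split: prod.splits)

lemma M_dprime_kronecker:
  "M_dprime (kronecker (transpose h) w) $ (\<nu>, \<mu>) $ (l, k) = h $ \<nu> $ \<mu> * w $ k $ l"
  by (simp add: M_dprime_def kronecker_def transpose_def)

end

theory Submission imports Defs begin

text \<open>Write \<open>z = Wz + H\<^sup>*Az\<close> with \<open>W = Id - H\<^sup>*A\<close>; as \<open>\<Sigma>\<^sub>k\<close> is subadditive, it suffices to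
  bound the two parts separately, and \<open>\<beta>[H]\<close> bounds the second one by homogeneity. For the first
  one, \<open>\<Sigma>\<^sub>k(Wz)\<close> equals \<open>Tr([Wz]h\<^sup>T)\<close> for some partial isometry \<open>h\<close> of rank at most \<open>k\<close>
  (Ky Fan). If \<open>z\<close> has nuclear norm 1, then \<open>h\<^sup>T \<otimes> z\<close> belongs to \<open>Z\<^sup>*\<^sub>k\<close>: the singular values of
  \<open>h\<^sup>T \<otimes> z\<close> and \<open>h \<otimes> z\<close> are products of those of \<open>h\<close> and \<open>z\<close>, and the third rearrangement has
  rank one and nuclear norm \<open>\<parallel>h\<parallel>\<^sub>F\<parallel>z\<parallel>\<^sub>F \<le> \<surd>k\<close>. Hence the sum for \<open>k = s\<close> and \<open>k = 2s\<close> is at most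
  \<open>Opt\<^sup>*[W]\<close>.\<close>

section \<open>Singular value decomposition\<close>

text \<open>A maximiser \<open>x\<close> of the quadratic form on the unit sphere of
  \<open>V\<close> is an eigenvector: the residual \<open>y = f x - c x\<close> lies in
  \<open>V\<close> and is orthogonal to \<open>x\<close>, and moving from \<open>x\<close> along a
  nonzero \<open>y\<close> would raise the Rayleigh quotient to first order.\<close>

lemma self_adjoint_eigenvector:
  fixes f :: "'a::euclidean_space \<Rightarrow> 'a"
  assumes f: "linear f" and sa: "\<And>x y. f x \<bullet> y = x \<bullet> f y"
    and V: "subspace V" "f ` V \<subseteq> V" "V \<noteq> {0}"
  obtains x c where "x \<in> V" "norm x = 1" "f x = c *\<^sub>R x"
proof -
  let ?S = "V \<inter> sphere 0 1"
  obtain w where w: "w \<in> V" "w \<noteq> 0"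
    using V(1,3) subspace_0 by blast
  then have "w /\<^sub>R norm w \<in> ?S"
    using subspace_scale[OF V(1)] by simp
  then have ne: "?S \<noteq> {}" by blast
  have "compact ?S"
    using closed_subspace[OF V(1)] by (simp add: closed_Int_compact)
  moreover have "continuous_on ?S (\<lambda>x. x \<bullet> f x)"
    using f by (intro continuous_intros linear_continuous_on) (simp add: linear_conv_bounded_linear)
  ultimately obtain x where x: "x \<in> ?S" and max: "\<And>y. y \<in> ?S \<Longrightarrow> y \<bullet> f y \<le> x \<bullet> f x"
    using continuous_attains_sup[OF _ ne] by blast
  define c where "c = x \<bullet> f x"
  have xV: "x \<in> V" and nx: "norm x = 1" using x by auto
  have xx: "x \<bullet> x = 1" using nx by (simp add: dot_square_norm)
  have quad: "y \<bullet> f y \<le> c * (y \<bullet> y)" if "y \<in> V" for y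
  proof (cases "y = 0")
    case True
    then show ?thesis by (simp add: linear_0[OF f])
  next
    case False
    then have "y /\<^sub>R norm y \<in> ?S"
      using subspace_scale[OF V(1)] that by simp
    from max[OF this] have "(y \<bullet> f y) / (norm y * norm y) \<le> c"
      by (simp add: c_def linear_scale[OF f] divide_inverse mult_ac)
    then show ?thesis
      using False by (simp add: divide_le_eq dot_square_norm power2_eq_square)
  qed
  define y where "y = f x - c *\<^sub>R x"
  have yV: "y \<in> V"
    unfolding y_def using V xV by (intro subspace_diff subspace_scale) auto
  have yx: "y \<bullet> x = 0" by (simp add: y_def c_def algebra_simps xx inner_commute)
  have yfx: "y \<bullet> f x = y \<bullet> y"
  proof -
    have "y \<bullet> y = y \<bullet> f x - c * (y \<bullet> x)" by (simp add: y_def algebra_simps)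
    then show ?thesis using yx by simp
  qed
  define b where "b = c * (y \<bullet> y) - y \<bullet> f y"
  \<comment> \<open>This is \<open>quad\<close> at \<open>x + t y\<close>: for every
    \<open>t\<close> the first-order gain must be absorbed by the second-order term.\<close>
  have key: "2 * t * (y \<bullet> y) \<le> t\<^sup>2 * b" for t
  proof -
    have "x + t *\<^sub>R y \<in> V" using V xV yV by (intro subspace_add subspace_scale)
    from quad[OF this] have "(x + t *\<^sub>R y) \<bullet> f (x + t *\<^sub>R y) \<le> c * ((x + t *\<^sub>R y) \<bullet> (x + t *\<^sub>R y))" .
    moreover have "x \<bullet> f y = y \<bullet> y" using sa[of x y] yfx by (simp add: inner_commute)
    ultimately show ?thesis
      using yx xx yfx
      by (simp add: linear_add[OF f] linear_scale[OF f] inner_add inner_commute[of x y] b_def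
          c_def[symmetric] algebra_simps power2_eq_square)
  qed
  have "y \<bullet> y \<le> 0"
  proof (rule ccontr)
    assume "\<not> y \<bullet> y \<le> 0"
    then have pos: "y \<bullet> y > 0" by linarith
    \<comment> \<open>Chosen so that \<open>t * b\<close> is at most \<open>y \<bullet> y\<close>;
      the added 1 keeps the denominator positive.\<close>
    define t where "t = (y \<bullet> y) / (\<bar>b\<bar> + 1)"
    have t: "t > 0" using pos by (simp add: t_def)
    have "t * b \<le> t * (\<bar>b\<bar> + 1)" using t by (intro mult_left_mono) auto
    also have "\<dots> = y \<bullet> y" by (simp add: t_def)
    finally have "t\<^sup>2 * b \<le> t * (y \<bullet> y)" using t by (simp add: power2_eq_square)
    with key[of t] have "t * (y \<bullet> y) \<le> 0" by simp
    with t have "y \<bullet> y \<le> 0" by (simp add: mult_le_0_iff)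
    with pos show False by linarith
  qed
  then have "y = 0" by (metis inner_gt_zero_iff not_le)
  then have "f x = c *\<^sub>R x" by (simp add: y_def)
  with xV nx show ?thesis by (rule that)
qed

text \<open>Induction on \<open>dim V\<close>: by self-adjointness, the part of \<open>V\<close>
  orthogonal to an eigenvector is again invariant. This is why invariant subspaces are treated
  instead of the whole space only.\<close>

lemma self_adjoint_eigenbasis_subspace:
  fixes f :: "'a::euclidean_space \<Rightarrow> 'a"
  assumes f: "linear f" and sa: "\<And>x y. f x \<bullet> y = x \<bullet> f y"
    and V: "subspace V" "f ` V \<subseteq> V"
  shows "\<exists>B\<subseteq>V. V \<subseteq> span B \<and> pairwise orthogonal B \<and> (\<forall>x\<in>B. norm x = 1 \<and> (\<exists>c. f x = c *\<^sub>R x))"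
  using V
proof (induction "dim V" arbitrary: V rule: less_induct)
  case less
  show ?case
  proof (cases "V = {0}")
    case True
    then show ?thesis by (intro exI[of _ "{}"]) auto
  next
    case False
    obtain x c where x: "x \<in> V" "norm x = 1" "f x = c *\<^sub>R x"
      using self_adjoint_eigenvector[OF f sa less.prems False] .
    have xx: "x \<bullet> x = 1" using x by (simp add: dot_square_norm)
    let ?W = "V \<inter> {y. x \<bullet> y = 0}"
    have W: "subspace ?W"
      by (intro subspace_inter less.prems subspace_hyperplane)
    have "f y \<in> ?W" if "y \<in> ?W" for y
      using that less.prems(2) sa[of x y] x(3) by auto
    then have fW: "f ` ?W \<subseteq> ?W" by blast
    have "x \<notin> ?W" using xx by simp
    with x(1) have "?W \<subset> V" by blast
    then have "dim ?W < dim V"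
      using less.prems(1) W by (metis dim_psubset span_eq_iff)
    from less.hyps[OF this W fW] obtain B where B: "B \<subseteq> ?W" "?W \<subseteq> span B"
      "pairwise orthogonal B" "\<And>y. y \<in> B \<Longrightarrow> norm y = 1 \<and> (\<exists>c. f y = c *\<^sub>R y)"
      by blast
    have "y \<in> span (insert x B)" if y: "y \<in> V" for y
    proof -
      have "y - (x \<bullet> y) *\<^sub>R x \<in> ?W"
        using y x(1) less.prems(1) xx by (simp add: subspace_diff subspace_scale inner_diff_right)
      then have "y - (x \<bullet> y) *\<^sub>R x \<in> span B" using B(2) by blast
      then show ?thesis unfolding span_insert by blast
    qed
    moreover have "pairwise orthogonal (insert x B)"
      using B(1,3) by (auto simp: pairwise_insert orthogonal_def inner_commute)
    ultimately show ?thesis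
      using B x less.prems by (intro exI[of _ "insert x B"]) auto
  qed
qed

text \<open>An orthonormal spanning set is independent, hence has \<open>CARD('n)\<close> elements.
  It can therefore be indexed by the type \<open>'n\<close> itself and serve as the columns of a
  square matrix.\<close>

lemma symmetric_matrix_eigenbasis:
  fixes S :: "real^'n::finite^'n"
  assumes S: "transpose S = S"
  obtains v :: "'n \<Rightarrow> real^'n" and d
  where "\<And>i j. v i \<bullet> v j = (if i = j then 1 else 0)" "\<And>i. S *v v i = d i *\<^sub>R v i"
proof -
  have "linear ((*v) S)" by simp
  moreover have "(S *v x) \<bullet> y = x \<bullet> (S *v y)" for x y
    by (metis S dot_lmul_matrix inner_commute transpose_matrix_vector)
  ultimately obtain B where B: "UNIV \<subseteq> span B" "pairwise orthogonal B"
    "\<And>x. x \<in> B \<Longrightarrow> norm x = 1 \<and> (\<exists>c. S *v x = c *\<^sub>R x)"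
    using self_adjoint_eigenbasis_subspace[of "(*v) S" UNIV] by auto
  have "0 \<notin> B" using B(3) by fastforce
  then have ind: "independent B" by (rule pairwise_orthogonal_independent[OF B(2)])
  then have fin: "finite B" by (rule independent_imp_finite)
  have "card B = CARD('n)"
    using B(1) ind dim_eq_card[of B "UNIV :: (real^'n) set"] by (simp add: top.extremum_unique)
  then obtain v where v: "bij_betw v (UNIV :: 'n set) B"
    using finite_same_card_bij[OF finite_class.finite_UNIV fin] by auto
  have vB: "v i \<in> B" for i using v by (auto simp: bij_betw_def)
  have "v i \<bullet> v j = (if i = j then 1 else 0)" for i j
  proof (cases "i = j")
    case True
    then show ?thesis using B(3)[OF vB[of j]] by (simp add: dot_square_norm)
  next
    case False
    then have "v i \<noteq> v j" using v by (auto simp: bij_betw_def inj_def)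
    then show ?thesis using B(2) vB False by (auto simp: pairwise_def orthogonal_def)
  qed
  moreover obtain d where "\<And>i. S *v v i = d i *\<^sub>R v i"
    using B(3)[OF vB] by metis
  ultimately show ?thesis by (rule that)
qed

section \<open>Characteristic polynomial and singular values in an eigenbasis\<close>

lemma map_matrix_const_poly_mult:
  "map_matrix (\<lambda>c. [:c:]) (A ** B) = map_matrix (\<lambda>c. [:c:]) A ** map_matrix (\<lambda>c. [:c:]) B"
  for A :: "real^'n::finite^'m::finite" and B :: "real^'k::finite^'n"
proof -
  have "[:sum f I:] = (\<Sum>i\<in>I. [:f i:])" for f :: "'n \<Rightarrow> real" and I
    by (simp add: poly_eq_iff coeff_sum coeff_pCons split: nat.split)
  then show ?thesis
    by (simp add: vec_eq_iff matrix_matrix_mult_def mult.commute)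
qed

text \<open>With the \<open>v j\<close> as columns of \<open>P\<close> and the \<open>d i\<close> on
  the diagonal of \<open>D\<close>, the identity \<open>S P = P D\<close> lifts to
  \<open>(X - S) P = P (X - D)\<close> over the polynomials. Taking determinants and cancelling that
  of \<open>P\<close> leaves a diagonal determinant.\<close>

lemma charpoly_mat_eigenbasis:
  fixes S :: "real^'n::finite^'n" and v :: "'n \<Rightarrow> real^'n"
  assumes v: "\<And>i j. v i \<bullet> v j = (if i = j then 1 else 0)"
    and d: "\<And>i. S *v v i = d i *\<^sub>R v i"
  shows "charpoly_mat S = (\<Prod>i\<in>UNIV. [:- d i, 1:])"
proof -
  let ?C = "map_matrix (\<lambda>c::real. [:c:])" and ?X = "mat [:0, 1::real:] :: real poly^'n^'n"
  define P where "P = (\<chi> i j. v j $ i)"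
  define D where "D = (\<chi> i j. if i = j then d i else 0)"
  have PP: "transpose P ** P = mat 1"
    using v by (simp add: P_def vec_eq_iff matrix_matrix_mult_def transpose_def mat_def inner_vec_def)
  then have PP': "P ** transpose P = mat 1"
    by (simp add: matrix_left_right_inverse)
  have "(S ** P) $ i $ j = (P ** D) $ i $ j" for i j
  proof -
    have "(S ** P) $ i $ j = (S *v v j) $ i"
      by (simp add: matrix_matrix_mult_def matrix_vector_mult_def P_def)
    also have "\<dots> = (P ** D) $ i $ j"
      by (simp add: d matrix_matrix_mult_def P_def D_def if_distrib[of "\<lambda>x. _ * x"] cong: if_cong)
    finally show ?thesis .
  qed
  then have SP: "S ** P = P ** D" by (simp add: vec_eq_iff)
  have C1: "?C (mat 1 :: real^'n^'n) = mat 1"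
    by (simp add: vec_eq_iff mat_def one_pCons)
  have X: "?X ** M = M ** ?X" for M
    by (simp add: vec_eq_iff mat_def matrix_matrix_mult_def if_distrib[of "\<lambda>x. x * _"]
        if_distrib[of "\<lambda>x. _ * x"] mult.commute cong: if_cong)
  have distr: "(K - L) ** M = K ** M - L ** M" "M ** (K - L) = M ** K - M ** L"
    for K L M :: "real poly^'n^'n"
    by (simp_all add: vec_eq_iff matrix_matrix_mult_def left_diff_distrib right_diff_distrib sum_subtractf)
  have "(?X - ?C S) ** ?C P = ?X ** ?C P - ?C S ** ?C P"
    by (rule distr)
  also have "\<dots> = ?C P ** ?X - ?C P ** ?C D"
    by (simp only: X SP map_matrix_const_poly_mult[symmetric])
  also have "\<dots> = ?C P ** (?X - ?C D)"
    by (rule distr(2)[symmetric])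
  finally have "det (?X - ?C S) * det (?C P) = det (?C P) * det (?X - ?C D)"
    by (metis det_mul)
  \<comment> \<open>\<open>P\<close> is orthogonal, so its determinant is a unit of the polynomial
    ring and may be cancelled.\<close>
  moreover have "det (?C P) * det (?C (transpose P)) = 1"
    by (metis det_mul map_matrix_const_poly_mult PP' C1 det_I)
  then have "det (?C P) \<noteq> 0" by auto
  ultimately have "charpoly_mat S = det (?X - ?C D)"
    by (simp add: charpoly_mat_def mult.commute)
  also have "\<dots> = (\<Prod>i\<in>UNIV. (?X - ?C D) $ i $ i)"
    by (rule det_diagonal) (simp add: mat_def D_def)
  also have "\<dots> = (\<Prod>i\<in>UNIV. [:- d i, 1:])"
    by (simp add: mat_def D_def)
  finally show ?thesis .
qed

text \<open>The roots of the characteristic polynomial, with multiplicity, are the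
  \<open>d i\<close>. The enumeration \<open>e\<close> ties each position of the sorted list to one
  eigenvector, also when eigenvalues coincide.\<close>

lemma singular_values_eigenbasis:
  fixes z :: "real^'n::finite^'m::finite" and v :: "'n \<Rightarrow> real^'n"
  assumes v: "\<And>i j. v i \<bullet> v j = (if i = j then 1 else 0)"
    and d: "\<And>i. (transpose z ** z) *v v i = d i *\<^sub>R v i"
  obtains e :: "nat \<Rightarrow> 'n"
  where "bij_betw e {..<CARD('n)} UNIV"
    "\<And>i j. i \<le> j \<Longrightarrow> j < CARD('n) \<Longrightarrow> sqrt (d (e j)) \<le> sqrt (d (e i))"
    "\<And>i. i < CARD('n) \<Longrightarrow> singular_values z ! i = sqrt (d (e i))"
proof -
  let ?f = "\<lambda>i. sqrt (d i)"
  obtain ys :: "'n list" where ys: "set ys = UNIV" "distinct ys"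
    using finite_distinct_list[OF finite_class.finite_UNIV] by blast
  \<comment> \<open>Indices are sorted rather than values, so that each value keeps its
    eigenvector.\<close>
  define xs where "xs = rev (sort_key ?f ys)"
  have xs: "set xs = UNIV" "distinct xs" using ys by (simp_all add: xs_def)
  then have len: "length xs = CARD('n)" by (metis distinct_card)
  have "proots (charpoly_mat (transpose z ** z)) = (\<Sum>i\<in>UNIV. {#d i#})"
    by (simp add: charpoly_mat_eigenbasis[OF v d] proots_prod)
  also have "\<dots> = image_mset d (mset_set UNIV)"
    by (simp add: sum_unfold_sum_mset)
  also have "mset_set UNIV = mset ys"
    using ys by (metis mset_set_set)
  finally have "singular_values z = rev (sort (map ?f ys))"
    by (simp add: singular_values_def image_mset.compositionality comp_def flip: mset_map)
  also have "sort (map ?f ys) = map ?f (sort_key ?f ys)"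
    by (rule properties_for_sort) (simp_all add: mset_map)
  also have "rev \<dots> = map ?f xs"
    by (simp add: xs_def rev_map)
  finally have sv: "singular_values z = map ?f xs" .
  have "sorted (rev (map ?f xs))" by (simp add: xs_def rev_map)
  then have "sorted_wrt (\<ge>) (map ?f xs)"
    by (simp add: sorted_wrt_rev)
  then have "?f (xs ! j) \<le> ?f (xs ! i)" if "i \<le> j" "j < CARD('n)" for i j
    using that len by (cases "i = j") (auto simp: sorted_wrt_iff_nth_less)
  moreover have "bij_betw ((!) xs) {..<CARD('n)} UNIV"
    using bij_betw_nth[OF xs(2)] len xs(1) by simp
  ultimately show ?thesis
    using that sv len by simp
qed

section \<open>Rank-one matrices, Bessel's inequality and the decomposition itself\<close>

definition outer :: "real^'m::finite \<Rightarrow> real^'n::finite \<Rightarrow> real^'n^'m" where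
  "outer x y = (\<chi> i j. x $ i * y $ j)"

lemma matrix_vector_mult_sum_left:
  fixes M :: "'i \<Rightarrow> real^'n::finite^'m::finite"
  shows "(\<Sum>i\<in>I. M i) *v w = (\<Sum>i\<in>I. M i *v w)"
  by (induction I rule: infinite_finite_induct) (simp_all add: matrix_vector_mult_add_rdistrib)

lemma inner_outer: "z \<bullet> outer x y = x \<bullet> (z *v y)"
  by (simp add: outer_def inner_vec_def matrix_vector_mult_def sum_distrib_left mult_ac)

lemma outer_mult_vec: "outer x y *v w = (y \<bullet> w) *\<^sub>R x"
  by (simp add: outer_def vec_eq_iff matrix_vector_mult_def inner_vec_def sum_distrib_right
      sum_distrib_left mult_ac)

lemma norm_outer: "norm (outer x y) = norm x * norm y"
proof -
  have "outer x y \<bullet> outer x y = (x \<bullet> x) * (y \<bullet> y)"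
    by (simp add: inner_outer outer_mult_vec mult.commute)
  then show ?thesis
    by (simp add: norm_eq_sqrt_inner real_sqrt_mult)
qed

text \<open>Zero vectors are allowed so that the left singular vectors belonging to the singular value 0
  can be taken to be 0.\<close>

definition sub_orthonormal :: "'i set \<Rightarrow> ('i \<Rightarrow> 'a::real_inner) \<Rightarrow> bool" where
  "sub_orthonormal I a \<longleftrightarrow> (\<forall>i\<in>I. norm (a i) \<le> 1 \<and> (\<forall>j\<in>I. i \<noteq> j \<longrightarrow> a i \<bullet> a j = 0))"

lemma sub_orthonormal_subset: "sub_orthonormal I a \<Longrightarrow> J \<subseteq> I \<Longrightarrow> sub_orthonormal J a"
  by (auto simp: sub_orthonormal_def)

lemma norm_sum_orthogonal:
  fixes a :: "'i \<Rightarrow> 'a::real_inner"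
  assumes "finite I" and "\<And>i j. i \<in> I \<Longrightarrow> j \<in> I \<Longrightarrow> i \<noteq> j \<Longrightarrow> a i \<bullet> a j = 0"
  shows "(norm (\<Sum>i\<in>I. c i *\<^sub>R a i))\<^sup>2 = (\<Sum>i\<in>I. (c i)\<^sup>2 * (norm (a i))\<^sup>2)"
proof -
  have "pairwise (\<lambda>i j. orthogonal (c i *\<^sub>R a i) (c j *\<^sub>R a j)) I"
    using assms(2) by (simp add: pairwise_def orthogonal_def)
  from norm_sum_Pythagorean[OF assms(1) this] show ?thesis
    by (simp add: power_mult_distrib)
qed

lemma norm_sum_sub_orthonormal_le:
  assumes "finite I" "sub_orthonormal I a"
  shows "(norm (\<Sum>i\<in>I. c i *\<^sub>R a i))\<^sup>2 \<le> (\<Sum>i\<in>I. (c i)\<^sup>2)"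
proof -
  have "(norm (\<Sum>i\<in>I. c i *\<^sub>R a i))\<^sup>2 = (\<Sum>i\<in>I. (c i)\<^sup>2 * (norm (a i))\<^sup>2)"
    using assms by (intro norm_sum_orthogonal) (auto simp: sub_orthonormal_def)
  also have "\<dots> \<le> (\<Sum>i\<in>I. (c i)\<^sup>2 * 1)"
    using assms(2) by (intro sum_mono mult_left_mono) (auto simp: sub_orthonormal_def power_le_one)
  finally show ?thesis by simp
qed

text \<open>The usual argument survives for vectors of norm at most 1: \<open>w\<close> may fail to
  be the projection of \<open>x\<close>, but the square of its norm is still at most
  \<open>x \<bullet> w\<close>, and expanding the square of \<open>norm (x - w)\<close>
  suffices.\<close>

lemma sub_orthonormal_Bessel:
  assumes "finite I" "sub_orthonormal I a"
  shows "(\<Sum>i\<in>I. (a i \<bullet> x)\<^sup>2) \<le> (norm x)\<^sup>2"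
proof -
  define w where "w = (\<Sum>i\<in>I. (a i \<bullet> x) *\<^sub>R a i)"
  have "x \<bullet> w = (\<Sum>i\<in>I. (a i \<bullet> x)\<^sup>2)"
    by (simp add: w_def inner_sum_right power2_eq_square inner_commute)
  moreover have "(norm w)\<^sup>2 \<le> (\<Sum>i\<in>I. (a i \<bullet> x)\<^sup>2)"
    unfolding w_def by (rule norm_sum_sub_orthonormal_le[OF assms])
  moreover have "0 \<le> (norm (x - w))\<^sup>2" by simp
  then have "0 \<le> (norm x)\<^sup>2 - 2 * (x \<bullet> w) + (norm w)\<^sup>2"
    by (simp add: power2_norm_eq_inner inner_diff inner_commute)
  ultimately show ?thesis by linarith
qed

lemma orthonormal_expansion:
  fixes v :: "'n::finite \<Rightarrow> real^'n"
  assumes v: "\<And>i j. v i \<bullet> v j = (if i = j then 1 else 0)"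
  shows "w = (\<Sum>k\<in>UNIV. (v k \<bullet> w) *\<^sub>R v k)"
proof -
  define P where "P = (\<chi> i j. v j $ i)"
  have "transpose P ** P = mat 1"
    using v by (simp add: P_def vec_eq_iff matrix_matrix_mult_def transpose_def mat_def inner_vec_def)
  then have "w = P *v (transpose P *v w)"
    by (simp add: matrix_left_right_inverse matrix_vector_mul_assoc del: transpose_matrix_vector)
  also have "\<dots> = (\<Sum>k\<in>UNIV. (v k \<bullet> w) *\<^sub>R v k)"
    by (simp add: vec_eq_iff matrix_vector_mult_def transpose_def P_def inner_vec_def mult.commute
        del: transpose_matrix_vector)
  finally show ?thesis .
qed

text \<open>The right vectors are orthonormal eigenvectors of \<open>transpose z ** z\<close>, in
  decreasing order of eigenvalue; the left ones are their normalised images under \<open>z\<close>.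
  Applying \<open>z\<close> to the expansion of a vector in the right ones yields the
  decomposition.\<close>

lemma singular_value_decomposition:
  fixes z :: "real^'n::finite^'m::finite"
  obtains a :: "nat \<Rightarrow> real^'m" and b :: "nat \<Rightarrow> real^'n" and \<sigma> :: "nat \<Rightarrow> real"
  where "z = (\<Sum>i<CARD('n). \<sigma> i *\<^sub>R outer (a i) (b i))"
    "sub_orthonormal {..<CARD('n)} a" "sub_orthonormal {..<CARD('n)} b"
    "\<And>i. i < CARD('n) \<Longrightarrow> a i \<bullet> (z *v b i) = \<sigma> i"
    "\<And>i. i < CARD('n) \<Longrightarrow> singular_values z ! i = \<sigma> i"
    "\<And>i j. i \<le> j \<Longrightarrow> j < CARD('n) \<Longrightarrow> \<sigma> j \<le> \<sigma> i"
    "\<And>i. i < CARD('n) \<Longrightarrow> 0 \<le> \<sigma> i"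
proof -
  let ?N = "CARD('n)"
  have "transpose (transpose z ** z) = transpose z ** z"
    by (simp add: matrix_transpose_mul)
  then obtain v :: "'n \<Rightarrow> real^'n" and d where
    v: "\<And>i j. v i \<bullet> v j = (if i = j then 1 else 0)" and
    d: "\<And>i. (transpose z ** z) *v v i = d i *\<^sub>R v i"
    by (rule symmetric_matrix_eigenbasis) blast
  \<comment> \<open>The Gram matrix of the images is diagonal. This gives both
    \<open>d i \<ge> 0\<close> and the orthogonality of the left vectors.\<close>
  have zv: "(z *v v i) \<bullet> (z *v v j) = (if i = j then d i else 0)" for i j
  proof -
    have "(z *v v i) \<bullet> (z *v v j) = (transpose z *v (z *v v i)) \<bullet> v j"
      by (simp add: dot_lmul_matrix)
    also have "\<dots> = (d i *\<^sub>R v i) \<bullet> v j"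
      by (simp add: matrix_vector_mul_assoc d del: transpose_matrix_vector)
    finally show ?thesis by (simp add: v)
  qed
  have d0: "0 \<le> d i" for i using zv[of i i] inner_ge_zero[of "z *v v i"] by simp
  obtain e :: "nat \<Rightarrow> 'n" where e: "bij_betw e {..<?N} UNIV"
    and dec: "\<And>i j. i \<le> j \<Longrightarrow> j < ?N \<Longrightarrow> sqrt (d (e j)) \<le> sqrt (d (e i))"
    and sv: "\<And>i. i < ?N \<Longrightarrow> singular_values z ! i = sqrt (d (e i))"
    using singular_values_eigenbasis[OF v d] by blast
  define \<sigma> where "\<sigma> = (\<lambda>i. sqrt (d (e i)))"
  define b where "b = (\<lambda>i. v (e i))"
  \<comment> \<open>For \<open>\<sigma> i = 0\<close> the junk value of the inverse makes \<open>a i = 0\<close>.\<close>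
  define a where "a = (\<lambda>i. (inverse (\<sigma> i)) *\<^sub>R (z *v b i))"
  have inj: "e i = e j \<longleftrightarrow> i = j" if "i < ?N" "j < ?N" for i j
    using e that by (auto simp: bij_betw_def inj_on_def)
  have \<sigma>2: "\<sigma> i * \<sigma> i = d (e i)" for i by (simp add: \<sigma>_def d0)
  have \<sigma>a: "\<sigma> i *\<^sub>R a i = z *v b i" for i
  proof (cases "\<sigma> i = 0")
    case True
    then have "(z *v b i) \<bullet> (z *v b i) = 0" using \<sigma>2[of i] zv[of "e i" "e i"] by (simp add: b_def)
    then show ?thesis using True by simp
  qed (simp add: a_def)
  have aa: "a i \<bullet> a j = (if i = j then (if \<sigma> i = 0 then 0 else 1) else 0)"
    if "i < ?N" "j < ?N" for i j
    using that by (simp add: a_def b_def zv inj field_simps flip: \<sigma>2)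
  show ?thesis
  proof (rule that[of \<sigma> a b])
    show "sub_orthonormal {..<?N} b"
      using inj by (simp add: sub_orthonormal_def b_def v norm_eq_sqrt_inner)
    show "sub_orthonormal {..<?N} a"
      by (simp add: sub_orthonormal_def aa norm_eq_sqrt_inner)
    show "a i \<bullet> (z *v b i) = \<sigma> i" if "i < ?N" for i
      using that by (simp add: \<sigma>a[symmetric] aa)
    have expand: "w = (\<Sum>i<?N. (b i \<bullet> w) *\<^sub>R b i)" for w
    proof -
      have "w = (\<Sum>k\<in>UNIV. (v k \<bullet> w) *\<^sub>R v k)"
        using v by (rule orthonormal_expansion)
      also have "\<dots> = (\<Sum>i<?N. (b i \<bullet> w) *\<^sub>R b i)"
        by (simp add: b_def sum.reindex_bij_betw[OF e, symmetric])
      finally show ?thesis .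
    qed
    have "z *v w = (\<Sum>i<?N. \<sigma> i *\<^sub>R outer (a i) (b i)) *v w" for w
    proof -
      have "z *v w = (\<Sum>i<?N. (b i \<bullet> w) *\<^sub>R (z *v b i))"
        by (subst expand)
          (simp add: linear_sum[OF matrix_vector_mul_linear] matrix_vector_mult_scaleR)
      also have "\<dots> = (\<Sum>i<?N. (\<sigma> i *\<^sub>R outer (a i) (b i)) *v w)"
        by (simp add: outer_mult_vec \<sigma>a[symmetric] mult.commute flip: scaleR_matrix_vector_assoc)
      also have "\<dots> = (\<Sum>i<?N. \<sigma> i *\<^sub>R outer (a i) (b i)) *v w"
        by (simp add: matrix_vector_mult_sum_left)
      finally show ?thesis .
    qed
    then show "z = (\<Sum>i<?N. \<sigma> i *\<^sub>R outer (a i) (b i))"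
      by (simp add: matrix_eq)
  qed (use dec sv d0 in \<open>auto simp: \<sigma>_def\<close>)
qed

section \<open>Ky Fan's variational principle\<close>

text \<open>A linear program whose optimum puts weight 1 on the \<open>k\<close> largest values.
  Subtracting a threshold \<open>t\<close> bounds each term by \<open>t * \<bar>c i\<bar>\<close>
  plus the excess of \<open>\<sigma> i\<close> over \<open>t\<close>, and the total weight is at
  most \<open>k\<close>.\<close>

lemma weighted_sum_le_sum_initial:
  fixes \<sigma> c :: "nat \<Rightarrow> real"
  assumes dec: "\<And>i j. i \<le> j \<Longrightarrow> j < N \<Longrightarrow> \<sigma> j \<le> \<sigma> i"
    and nonneg: "\<And>i. i < N \<Longrightarrow> 0 \<le> \<sigma> i"
    and c: "\<And>i. i < N \<Longrightarrow> \<bar>c i\<bar> \<le> 1" "(\<Sum>i<N. \<bar>c i\<bar>) \<le> real k"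
  shows "(\<Sum>i<N. \<sigma> i * c i) \<le> (\<Sum>i<min k N. \<sigma> i)"
proof (cases "k < N")
  case False
  have "\<sigma> i * c i \<le> \<sigma> i" if "i < N" for i
    using mult_left_mono[of "c i" 1 "\<sigma> i"] nonneg[OF that] c(1)[OF that] by auto
  then show ?thesis using False by (auto intro: sum_mono simp: min.absorb2)
next
  case True
  \<comment> \<open>As \<open>\<sigma>\<close> is numbered from 0, this is the first value left out
    of the sum.\<close>
  define t where "t = \<sigma> k"
  have "\<sigma> i * c i \<le> t * \<bar>c i\<bar> + (if i < k then \<sigma> i - t else 0)" if i: "i < N" for i
  proof -
    have "\<sigma> i * c i \<le> \<sigma> i * \<bar>c i\<bar>"
      using nonneg[OF i] by (intro mult_left_mono) auto
    also have "\<dots> = t * \<bar>c i\<bar> + (\<sigma> i - t) * \<bar>c i\<bar>" by (simp add: algebra_simps)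
    also have "(\<sigma> i - t) * \<bar>c i\<bar> \<le> (if i < k then \<sigma> i - t else 0)"
    proof (cases "i < k")
      case True
      then have "0 \<le> \<sigma> i - t" using dec[of i k] \<open>k < N\<close> by (simp add: t_def)
      then show ?thesis using True c(1)[OF i] mult_left_mono[of "\<bar>c i\<bar>" 1 "\<sigma> i - t"] by simp
    next
      case False
      then have "\<sigma> i - t \<le> 0" using dec[of k i] i by (simp add: t_def)
      then show ?thesis using False by (simp add: mult_nonpos_nonneg)
    qed
    finally show ?thesis by simp
  qed
  then have "(\<Sum>i<N. \<sigma> i * c i) \<le> (\<Sum>i<N. t * \<bar>c i\<bar> + (if i < k then \<sigma> i - t else 0))"
    by (intro sum_mono) simp
  also have "\<dots> = t * (\<Sum>i<N. \<bar>c i\<bar>) + (\<Sum>i<N. if i < k then \<sigma> i - t else 0)"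
    by (simp add: sum.distrib sum_distrib_left)
  also have "(\<Sum>i<N. if i < k then \<sigma> i - t else 0) = (\<Sum>i<k. \<sigma> i - t)"
    using True by (intro sum.mono_neutral_cong_right) auto
  also have "t * (\<Sum>i<N. \<bar>c i\<bar>) \<le> t * k"
    using c(2) nonneg[OF True] by (intro mult_left_mono) (auto simp: t_def)
  finally show ?thesis using True by (simp add: sum_subtractf)
qed

lemma Sigma_sum_alt:
  "Sigma_sum k z = (\<Sum>i<min k CARD('n). singular_values z ! i)" for z :: "real^'n::finite^'m::finite"
proof -
  have "{1..n} = Suc ` {..<n}" for n by (auto simp: image_iff gr0_conv_Suc Suc_le_eq)
  then show ?thesis
    by (simp add: Sigma_sum_def singular_value_def sum.reindex)
qed

text \<open>The upper half of Ky Fan's principle. Inserting the decomposition of \<open>z\<close>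
  turns the inner product into a weighted sum of singular values; the weights are at most 1 each and
  \<open>k\<close> in total.\<close>

lemma inner_partial_isometry_le_Sigma_sum:
  fixes z :: "real^'n::finite^'m::finite"
  assumes I: "finite I" "card I \<le> k" and u: "sub_orthonormal I u" and v: "sub_orthonormal I v"
  shows "z \<bullet> (\<Sum>i\<in>I. outer (u i) (v i)) \<le> Sigma_sum k z"
proof -
  let ?N = "CARD('n)"
  obtain a :: "nat \<Rightarrow> real^'m" and b :: "nat \<Rightarrow> real^'n" and \<sigma> where
    z: "z = (\<Sum>i<?N. \<sigma> i *\<^sub>R outer (a i) (b i))" and
    ab: "sub_orthonormal {..<?N} a" "sub_orthonormal {..<?N} b" and
    sv: "\<And>i. i < ?N \<Longrightarrow> singular_values z ! i = \<sigma> i" and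
    dec: "\<And>i j. i \<le> j \<Longrightarrow> j < ?N \<Longrightarrow> \<sigma> j \<le> \<sigma> i" "\<And>i. i < ?N \<Longrightarrow> 0 \<le> \<sigma> i"
    by (rule singular_value_decomposition[of z]) blast
  \<comment> \<open>The inner product of the given matrix with the \<open>j\<close>-th singular
    rank-one term.\<close>
  define c where "c = (\<lambda>j. \<Sum>i\<in>I. (u i \<bullet> a j) * (v i \<bullet> b j))"
  \<comment> \<open>The products are split into squares so that Bessel's inequality applies in both
    directions: over \<open>i\<close> for a single weight, over \<open>j\<close> for their
    total.\<close>
  have *: "\<bar>c j\<bar> \<le> (\<Sum>i\<in>I. ((u i \<bullet> a j)\<^sup>2 + (v i \<bullet> b j)\<^sup>2) / 2)" for j
  proof -
    have "\<bar>x * y\<bar> \<le> (x\<^sup>2 + y\<^sup>2) / 2" for x y :: real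
      using sum_squares_bound[of "\<bar>x\<bar>" "\<bar>y\<bar>"] by (simp add: abs_mult)
    then show ?thesis unfolding c_def by (intro order_trans[OF sum_abs] sum_mono)
  qed
  have c1: "\<bar>c j\<bar> \<le> 1" if j: "j < ?N" for j
  proof -
    have "(\<Sum>i\<in>I. (u i \<bullet> a j)\<^sup>2) \<le> 1" "(\<Sum>i\<in>I. (v i \<bullet> b j)\<^sup>2) \<le> 1"
      using sub_orthonormal_Bessel[OF I(1) u, of "a j"] sub_orthonormal_Bessel[OF I(1) v, of "b j"]
        ab j power_le_one[of "norm (a j)" 2] power_le_one[of "norm (b j)" 2]
      by (auto simp: sub_orthonormal_def intro: order_trans)
    then show ?thesis using *[of j] by (simp add: sum_divide_distrib[symmetric] sum.distrib)
  qed
  have "(\<Sum>j<?N. \<bar>c j\<bar>) \<le> (\<Sum>j<?N. \<Sum>i\<in>I. ((u i \<bullet> a j)\<^sup>2 + (v i \<bullet> b j)\<^sup>2) / 2)"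
    by (intro sum_mono *)
  also have "\<dots> = (\<Sum>i\<in>I. ((\<Sum>j<?N. (u i \<bullet> a j)\<^sup>2) + (\<Sum>j<?N. (v i \<bullet> b j)\<^sup>2)) / 2)"
    by (subst sum.swap) (simp add: sum_divide_distrib[symmetric] sum.distrib)
  also have "\<dots> \<le> (\<Sum>i\<in>I. (1 + 1) / 2)"
  proof (intro sum_mono divide_right_mono add_mono)
    fix i assume i: "i \<in> I"
    show "(\<Sum>j<?N. (u i \<bullet> a j)\<^sup>2) \<le> 1"
      using sub_orthonormal_Bessel[OF _ ab(1), of "u i"] u i power_le_one[of "norm (u i)" 2]
      by (auto simp: sub_orthonormal_def inner_commute intro: order_trans)
    show "(\<Sum>j<?N. (v i \<bullet> b j)\<^sup>2) \<le> 1"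
      using sub_orthonormal_Bessel[OF _ ab(2), of "v i"] v i power_le_one[of "norm (v i)" 2]
      by (auto simp: sub_orthonormal_def inner_commute intro: order_trans)
  qed auto
  also have "\<dots> \<le> real k" using I(2) by simp
  finally have ck: "(\<Sum>j<?N. \<bar>c j\<bar>) \<le> real k" .
  have "z \<bullet> (\<Sum>i\<in>I. outer (u i) (v i)) = (\<Sum>j<?N. \<sigma> j * c j)"
    by (subst z) (simp add: c_def inner_sum_left inner_sum_right inner_outer outer_mult_vec
        inner_commute mult_ac)
  also have "\<dots> \<le> (\<Sum>i<min k ?N. \<sigma> i)"
    using dec c1 ck by (rule weighted_sum_le_sum_initial)
  also have "\<dots> = Sigma_sum k z"
    by (simp add: Sigma_sum_alt sv)
  finally show ?thesis .
qed

text \<open>The leading singular pairs attain the bound. So \<open>Sigma_sum k\<close> is a maximum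
  of linear functionals, and an upper bound for it need only be checked on the functional obtained
  here.\<close>

lemma Sigma_sum_attained:
  fixes z :: "real^'n::finite^'m::finite"
  obtains I :: "nat set" and u v where "finite I" "card I \<le> k" "sub_orthonormal I u" "sub_orthonormal I v"
    "Sigma_sum k z = z \<bullet> (\<Sum>i\<in>I. outer (u i) (v i))"
proof -
  let ?N = "CARD('n)"
  obtain a :: "nat \<Rightarrow> real^'m" and b :: "nat \<Rightarrow> real^'n" and \<sigma> where
    ab: "sub_orthonormal {..<?N} a" "sub_orthonormal {..<?N} b" and
    "\<And>i. i < ?N \<Longrightarrow> a i \<bullet> (z *v b i) = \<sigma> i"
    "\<And>i. i < ?N \<Longrightarrow> singular_values z ! i = \<sigma> i"
    by (rule singular_value_decomposition[of z]) blast
  then have "Sigma_sum k z = z \<bullet> (\<Sum>i<min k ?N. outer (a i) (b i))"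
    by (simp add: Sigma_sum_alt inner_sum_right inner_outer)
  moreover have "{..<min k ?N} \<subseteq> {..<?N}" by auto
  ultimately show ?thesis
    using ab by (intro that[of "{..<min k ?N}" a b]) (auto elim: sub_orthonormal_subset)
qed

section \<open>Consequences for the norms\<close>

lemma nuclear_norm_eq_Sigma_sum: "nuclear_norm z = Sigma_sum CARD('n) z"
  for z :: "real^'n::finite^'m::finite"
  by (simp add: nuclear_norm_def Sigma_sum_def)

lemma spectral_norm_eq_Sigma_sum: "spectral_norm z = Sigma_sum 1 z"
  for z :: "real^'n::finite^'m::finite"
proof -
  have "min 1 CARD('n) = 1" by (simp add: min_def Suc_le_eq)
  then show ?thesis by (simp add: spectral_norm_def Sigma_sum_def)
qed

text \<open>The functional that attains the value at \<open>x + y\<close> is bounded at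
  \<open>x\<close> and at \<open>y\<close> separately.\<close>

lemma Sigma_sum_add: "Sigma_sum k (x + y) \<le> Sigma_sum k x + Sigma_sum k y"
  for x y :: "real^'n::finite^'m::finite"
  by (rule Sigma_sum_attained[of k "x + y"])
    (simp add: inner_add_left add_mono inner_partial_isometry_le_Sigma_sum)

lemma Sigma_sum_scaleR: "Sigma_sum k (c *\<^sub>R z) = c * Sigma_sum k z" if c: "0 \<le> c"
  for z :: "real^'n::finite^'m::finite"
proof (rule antisym)
  show "Sigma_sum k (c *\<^sub>R z) \<le> c * Sigma_sum k z"
    by (rule Sigma_sum_attained[of k "c *\<^sub>R z"])
      (simp add: mult_left_mono c inner_partial_isometry_le_Sigma_sum)
  show "c * Sigma_sum k z \<le> Sigma_sum k (c *\<^sub>R z)"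
  proof (rule Sigma_sum_attained[of k z])
    fix I :: "nat set" and u v
    assume *: "finite I" "card I \<le> k" "sub_orthonormal I u" "sub_orthonormal I v"
      and "Sigma_sum k z = z \<bullet> (\<Sum>i\<in>I. outer (u i) (v i))"
    then have "c * Sigma_sum k z = (c *\<^sub>R z) \<bullet> (\<Sum>i\<in>I. outer (u i) (v i))" by simp
    also have "\<dots> \<le> Sigma_sum k (c *\<^sub>R z)"
      using * by (rule inner_partial_isometry_le_Sigma_sum)
    finally show ?thesis .
  qed
qed

lemma transpose_sum_outer: "transpose (\<Sum>i\<in>I. outer (u i) (v i)) = (\<Sum>i\<in>I. outer (v i) (u i))"
  by (simp add: vec_eq_iff transpose_def outer_def mult.commute)

text \<open>The image is the combination of the \<open>u i\<close> with coefficients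
  \<open>v i \<bullet> x\<close>, whose squares are summed by Bessel's inequality.\<close>

lemma norm_partial_isometry_le:
  assumes "finite I" "sub_orthonormal I u" "sub_orthonormal I v"
  shows "norm ((\<Sum>i\<in>I. outer (u i) (v i)) *v x) \<le> norm x"
proof -
  have "(norm ((\<Sum>i\<in>I. outer (u i) (v i)) *v x))\<^sup>2 = (norm (\<Sum>i\<in>I. (v i \<bullet> x) *\<^sub>R u i))\<^sup>2"
    by (simp add: matrix_vector_mult_sum_left outer_mult_vec)
  also have "\<dots> \<le> (norm x)\<^sup>2"
    using norm_sum_sub_orthonormal_le[OF assms(1,2)] sub_orthonormal_Bessel[OF assms(1,3)]
    by (rule order_trans)
  finally show ?thesis by simp
qed

text \<open>The rank-one terms are themselves sub-orthonormal for the Frobenius inner product. This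
  is the source of the square root in the bound on \<open>M_dprime\<close>.\<close>

lemma norm_partial_isometry_square_le:
  assumes "finite I" "sub_orthonormal I u" "sub_orthonormal I v"
  shows "(norm (\<Sum>i\<in>I. outer (u i) (v i)))\<^sup>2 \<le> card I"
proof -
  have "sub_orthonormal I (\<lambda>i. outer (u i) (v i))"
    using assms(2,3)
    by (auto simp: sub_orthonormal_def norm_outer inner_outer outer_mult_vec intro: mult_le_one)
  from norm_sum_sub_orthonormal_le[OF assms(1) this, of "\<lambda>_. 1"] show ?thesis by simp
qed

text \<open>The attaining matrix is a contraction, so its pairing with each rank-one term obeys
  Cauchy-Schwarz. Any rank-one decomposition thus bounds the nuclear norm from above.\<close>

lemma Sigma_sum_sum_outer_le:
  fixes x :: "'i \<Rightarrow> real^'m::finite" and y :: "'i \<Rightarrow> real^'n::finite"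
  shows "Sigma_sum k (\<Sum>i\<in>I. outer (x i) (y i)) \<le> (\<Sum>i\<in>I. norm (x i) * norm (y i))"
proof (rule Sigma_sum_attained[of k "\<Sum>i\<in>I. outer (x i) (y i)"])
  fix J :: "nat set" and u v
  assume J: "finite J" "sub_orthonormal J u" "sub_orthonormal J v"
    and eq: "Sigma_sum k (\<Sum>i\<in>I. outer (x i) (y i)) =
      (\<Sum>i\<in>I. outer (x i) (y i)) \<bullet> (\<Sum>j\<in>J. outer (u j) (v j))"
  let ?h = "\<Sum>j\<in>J. outer (u j) (v j)"
  have "Sigma_sum k (\<Sum>i\<in>I. outer (x i) (y i)) = (\<Sum>i\<in>I. x i \<bullet> (?h *v y i))"
    unfolding eq by (simp add: inner_commute[of _ ?h] inner_sum_right[of ?h] inner_outer)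
  also have "\<dots> \<le> (\<Sum>i\<in>I. norm (x i) * norm (y i))"
    by (intro sum_mono order_trans[OF norm_cauchy_schwarz] mult_left_mono
        norm_partial_isometry_le J) simp
  finally show ?thesis .
qed

lemma spectral_norm_le:
  fixes M :: "real^'n::finite^'m::finite"
  assumes M: "\<And>x. norm (M *v x) \<le> c * norm x" and c: "0 \<le> c"
  shows "spectral_norm M \<le> c"
proof (rule Sigma_sum_attained[of 1 M])
  fix I :: "nat set" and u v
  assume I: "finite I" "card I \<le> 1" and u: "sub_orthonormal I u" and v: "sub_orthonormal I v"
    and eq: "Sigma_sum 1 M = M \<bullet> (\<Sum>i\<in>I. outer (u i) (v i))"
  have "spectral_norm M = (\<Sum>i\<in>I. u i \<bullet> (M *v v i))"
    unfolding spectral_norm_eq_Sigma_sum eq by (simp add: inner_sum_right inner_outer)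
  also have "\<dots> \<le> (\<Sum>i\<in>I. c)"
  proof (intro sum_mono)
    fix i assume "i \<in> I"
    then have n: "norm (u i) \<le> 1" "norm (v i) \<le> 1"
      using u v by (auto simp: sub_orthonormal_def)
    have "u i \<bullet> (M *v v i) \<le> norm (u i) * norm (M *v v i)" by (rule norm_cauchy_schwarz)
    also have "\<dots> \<le> 1 * (c * norm (v i))" using n by (intro mult_mono M) auto
    also have "\<dots> \<le> c" using n(2) c by (simp add: mult_left_le)
    finally show "u i \<bullet> (M *v v i) \<le> c" .
  qed
  also have "\<dots> \<le> c" using I(2) c mult_right_mono[of "real (card I)" 1 c] by simp
  finally show ?thesis .
qed

text \<open>The converse of the bound by rank-one decompositions: the singular one, with
  \<open>\<sigma> i\<close> absorbed into the left factor, costs no more than the nuclear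
  norm.\<close>

lemma nuclear_norm_decomposition:
  fixes z :: "real^'n::finite^'m::finite"
  obtains x :: "nat \<Rightarrow> real^'m" and y :: "nat \<Rightarrow> real^'n"
  where "z = (\<Sum>i<CARD('n). outer (x i) (y i))"
    "(\<Sum>i<CARD('n). norm (x i) * norm (y i)) \<le> nuclear_norm z"
proof -
  let ?N = "CARD('n)"
  obtain a :: "nat \<Rightarrow> real^'m" and b :: "nat \<Rightarrow> real^'n" and \<sigma> where
    z: "z = (\<Sum>i<?N. \<sigma> i *\<^sub>R outer (a i) (b i))" and
    ab: "sub_orthonormal {..<?N} a" "sub_orthonormal {..<?N} b" and
    sv: "\<And>i. i < ?N \<Longrightarrow> singular_values z ! i = \<sigma> i" and
    nonneg: "\<And>i. i < ?N \<Longrightarrow> 0 \<le> \<sigma> i"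
    by (rule singular_value_decomposition[of z]) blast
  have "norm (\<sigma> i *\<^sub>R a i) * norm (b i) \<le> \<sigma> i" if "i < ?N" for i
  proof -
    have "norm (a i) * norm (b i) \<le> 1"
      using ab that by (intro mult_le_one) (auto simp: sub_orthonormal_def)
    then show ?thesis
      using nonneg[OF that] mult_left_mono[of "norm (a i) * norm (b i)" 1 "\<sigma> i"]
      by (simp add: mult.assoc)
  qed
  then have "(\<Sum>i<?N. norm (\<sigma> i *\<^sub>R a i) * norm (b i)) \<le> (\<Sum>i<?N. \<sigma> i)"
    by (intro sum_mono) simp
  also have "\<dots> = nuclear_norm z"
    by (simp add: nuclear_norm_eq_Sigma_sum Sigma_sum_alt sv)
  finally have "(\<Sum>i<?N. norm (\<sigma> i *\<^sub>R a i) * norm (b i)) \<le> nuclear_norm z" .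
  moreover have "z = (\<Sum>i<?N. outer (\<sigma> i *\<^sub>R a i) (b i))"
    by (subst z) (simp add: outer_def vec_eq_iff mult.assoc)
  ultimately show ?thesis by (intro that)
qed

lemma norm_le_nuclear_norm: "norm z \<le> nuclear_norm z" for z :: "real^'n::finite^'m::finite"
proof (rule nuclear_norm_decomposition[of z])
  fix x :: "nat \<Rightarrow> real^'m" and y :: "nat \<Rightarrow> real^'n"
  assume z: "z = (\<Sum>i<CARD('n). outer (x i) (y i))"
    and le: "(\<Sum>i<CARD('n). norm (x i) * norm (y i)) \<le> nuclear_norm z"
  have "norm z \<le> (\<Sum>i<CARD('n). norm (x i) * norm (y i))"
    by (subst z) (rule order_trans[OF norm_sum], simp add: norm_outer)
  with le show ?thesis by simp
qed

text \<open>Cauchy-Schwarz against the rank-one matrix \<open>outer (z *v w) w\<close>, followed by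
  cancelling \<open>norm (z *v w)\<close>.\<close>

lemma norm_mult_vec_le_Frobenius: "norm (z *v w) \<le> norm z * norm w"
  for z :: "real^'n::finite^'m::finite"
proof -
  have "(norm (z *v w))\<^sup>2 = z \<bullet> outer (z *v w) w"
    by (simp add: inner_outer power2_norm_eq_inner)
  also have "\<dots> \<le> norm z * (norm (z *v w) * norm w)"
    using norm_cauchy_schwarz[of z "outer (z *v w) w"] by (simp add: norm_outer)
  finally have "norm (z *v w) * norm (z *v w) \<le> norm (z *v w) * (norm z * norm w)"
    by (simp add: power2_eq_square mult_ac)
  then show ?thesis
    by (cases "norm (z *v w) = 0") (simp_all add: mult_le_cancel_left_pos)
qed

section \<open>Kronecker products\<close>

lemma norm_square_vec_prod: "(norm x)\<^sup>2 = (\<Sum>a\<in>UNIV. \<Sum>b\<in>UNIV. (x $ (a, b))\<^sup>2)"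
  for x :: "real^('a::finite \<times> 'b::finite)"
  unfolding power2_norm_eq_inner inner_vec_def
  by (simp add: power2_eq_square sum.cartesian_product)

lemma norm_square_vec: "(norm x)\<^sup>2 = (\<Sum>a\<in>UNIV. (x $ a)\<^sup>2)" for x :: "real^'a::finite"
  unfolding power2_norm_eq_inner inner_vec_def by (simp add: power2_eq_square)

lemma norm_square_matrix: "(norm x)\<^sup>2 = (\<Sum>a\<in>UNIV. \<Sum>b\<in>UNIV. (x $ a $ b)\<^sup>2)"
  for x :: "real^'b::finite^'a::finite"
  unfolding power2_norm_eq_inner inner_vec_def by (simp add: power2_eq_square)

lemma norm_kronecker_mult_vec_le:
  fixes A :: "real^'b::finite^'a::finite" and B :: "real^'d::finite^'c::finite"
  assumes A: "\<And>x. norm (A *v x) \<le> \<alpha> * norm x" and B: "\<And>x. norm (B *v x) \<le> \<beta> * norm x"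
    and nonneg: "0 \<le> \<alpha>" "0 \<le> \<beta>"
  shows "norm (kronecker A B *v x) \<le> \<alpha> * \<beta> * norm x"
proof -
  \<comment> \<open>\<open>y b\<close> is the \<open>b\<close>-th block of \<open>x\<close>. The
    product acts by \<open>B\<close> inside each block and then, for each fixed coordinate
    \<open>c\<close>, by \<open>A\<close> across the blocks; \<open>w c\<close> is the vector that
    \<open>A\<close> meets.\<close>
  define y where "y = (\<lambda>b. \<chi> d. x $ (b, d))"
  define w where "w = (\<lambda>c. \<chi> b. (B *v y b) $ c)"
  have A2: "(norm (A *v x))\<^sup>2 \<le> \<alpha>\<^sup>2 * (norm x)\<^sup>2" for x
    using power_mono[OF A[of x], of 2] by (simp add: power_mult_distrib)
  have B2: "(norm (B *v x))\<^sup>2 \<le> \<beta>\<^sup>2 * (norm x)\<^sup>2" for x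
    using power_mono[OF B[of x], of 2] by (simp add: power_mult_distrib)
  have y2: "(norm (y b))\<^sup>2 = (\<Sum>d\<in>UNIV. (x $ (b, d))\<^sup>2)" for b
    by (simp add: norm_square_vec y_def)
  have "(kronecker A B *v x) $ (a, c) = (A *v w c) $ a" for a c
    by (simp add: kronecker_def matrix_vector_mult_def w_def y_def sum_distrib_left mult.assoc
        sum.cartesian_product case_prod_unfold)
  then have "(norm (kronecker A B *v x))\<^sup>2 = (\<Sum>a\<in>UNIV. \<Sum>c\<in>UNIV. ((A *v w c) $ a)\<^sup>2)"
    by (simp add: norm_square_vec_prod)
  also have "\<dots> = (\<Sum>c\<in>UNIV. (norm (A *v w c))\<^sup>2)"
    by (subst sum.swap) (simp add: norm_square_vec)
  also have "\<dots> \<le> (\<Sum>c\<in>UNIV. \<alpha>\<^sup>2 * (norm (w c))\<^sup>2)"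
    by (intro sum_mono A2)
  also have "\<dots> = \<alpha>\<^sup>2 * (\<Sum>c\<in>UNIV. \<Sum>b\<in>UNIV. ((B *v y b) $ c)\<^sup>2)"
    by (simp add: norm_square_vec w_def sum_distrib_left)
  also have "\<dots> = \<alpha>\<^sup>2 * (\<Sum>b\<in>UNIV. (norm (B *v y b))\<^sup>2)"
    by (subst sum.swap) (simp add: norm_square_vec)
  also have "\<dots> \<le> \<alpha>\<^sup>2 * (\<Sum>b\<in>UNIV. \<beta>\<^sup>2 * (norm (y b))\<^sup>2)"
    by (intro mult_left_mono sum_mono B2) simp
  also have "\<dots> = \<alpha>\<^sup>2 * \<beta>\<^sup>2 * (norm x)\<^sup>2"
    by (simp add: norm_square_vec_prod[of x] y2 sum_distrib_left mult.assoc)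
  finally have "(norm (kronecker A B *v x))\<^sup>2 \<le> (\<alpha> * \<beta> * norm x)\<^sup>2"
    by (simp add: power_mult_distrib)
  then show ?thesis by (rule power2_le_imp_le) (simp add: nonneg)
qed

definition kron_vec :: "real^'a::finite \<Rightarrow> real^'b::finite \<Rightarrow> real^('a \<times> 'b)" where
  "kron_vec x y = (\<chi> r. x $ fst r * y $ snd r)"

lemma norm_kron_vec: "norm (kron_vec x y) = norm x * norm y"
proof -
  have "(norm (kron_vec x y))\<^sup>2 = (norm x * norm y)\<^sup>2"
    by (simp add: norm_square_vec_prod norm_square_vec kron_vec_def power_mult_distrib sum_product)
  then show ?thesis by simp
qed

text \<open>A Kronecker product of rank-one matrices has rank one, with factors
  \<open>kron_vec\<close> whose norms multiply. The double sum is therefore a rank-one decomposition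
  of the stated cost.\<close>

lemma nuclear_norm_kronecker_le:
  fixes x :: "'i \<Rightarrow> real^'a::finite" and y :: "'i \<Rightarrow> real^'b::finite"
    and x' :: "'j \<Rightarrow> real^'c::finite" and y' :: "'j \<Rightarrow> real^'d::finite"
  shows "nuclear_norm (kronecker (\<Sum>i\<in>I. outer (x i) (y i)) (\<Sum>j\<in>J. outer (x' j) (y' j)))
    \<le> (\<Sum>i\<in>I. norm (x i) * norm (y i)) * (\<Sum>j\<in>J. norm (x' j) * norm (y' j))"
proof -
  have "kronecker (\<Sum>i\<in>I. outer (x i) (y i)) (\<Sum>j\<in>J. outer (x' j) (y' j))
      = (\<Sum>p\<in>I \<times> J. outer (kron_vec (x (fst p)) (x' (snd p))) (kron_vec (y (fst p)) (y' (snd p))))"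
    by (simp add: vec_eq_iff kronecker_def outer_def kron_vec_def sum_product sum.cartesian_product
        case_prod_unfold mult_ac)
  then have "nuclear_norm (kronecker (\<Sum>i\<in>I. outer (x i) (y i)) (\<Sum>j\<in>J. outer (x' j) (y' j)))
      \<le> (\<Sum>p\<in>I \<times> J. norm (kron_vec (x (fst p)) (x' (snd p))) * norm (kron_vec (y (fst p)) (y' (snd p))))"
    by (simp only: nuclear_norm_eq_Sigma_sum Sigma_sum_sum_outer_le)
  also have "\<dots> = (\<Sum>i\<in>I. norm (x i) * norm (y i)) * (\<Sum>j\<in>J. norm (x' j) * norm (y' j))"
    by (simp add: norm_kron_vec sum_product sum.cartesian_product case_prod_unfold mult_ac)
  finally show ?thesis .
qed

text \<open>Turns a Ky Fan functional into a feasible point. Nuclear bounds come from rank-one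
  decompositions of cost at most \<open>k\<close> and 1, spectral bounds from both factors being
  contractions.\<close>

lemma kronecker_in_Z_star:
  fixes u :: "'i \<Rightarrow> real^'p::finite" and v :: "'i \<Rightarrow> real^'q::finite" and z :: "real^'q^'p"
  assumes I: "finite I" "card I \<le> k" and u: "sub_orthonormal I u" and v: "sub_orthonormal I v"
    and z: "nuclear_norm z \<le> 1"
  shows "kronecker (transpose (\<Sum>i\<in>I. outer (u i) (v i))) z \<in> Z_star k"
proof -
  let ?h = "\<Sum>i\<in>I. outer (u i) (v i)"
  obtain x :: "nat \<Rightarrow> real^'p" and y :: "nat \<Rightarrow> real^'q"
    where xy: "z = (\<Sum>i<CARD('q). outer (x i) (y i))"
      and "(\<Sum>i<CARD('q). norm (x i) * norm (y i)) \<le> nuclear_norm z"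
    by (rule nuclear_norm_decomposition)
  with z have xy1: "(\<Sum>i<CARD('q). norm (x i) * norm (y i)) \<le> 1" by linarith
  have "norm (u i) * norm (v i) \<le> 1" if "i \<in> I" for i
    using u v that by (intro mult_le_one) (auto simp: sub_orthonormal_def)
  then have "(\<Sum>i\<in>I. norm (u i) * norm (v i)) \<le> (\<Sum>i\<in>I. 1)" by (intro sum_mono)
  also have "\<dots> \<le> real k" using I(2) by simp
  finally have uv: "(\<Sum>i\<in>I. norm (u i) * norm (v i)) \<le> real k" .
  then have prod: "(\<Sum>i\<in>I. norm (u i) * norm (v i)) * (\<Sum>i<CARD('q). norm (x i) * norm (y i)) \<le> real k"
    using mult_mono[OF uv xy1] by (simp add: sum_nonneg)
  have nz: "norm z \<le> 1" using norm_le_nuclear_norm[of z] z by linarith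
  have zw: "norm (z *v w) \<le> 1 * norm w" for w
    using norm_mult_vec_le_Frobenius[of z w] mult_right_mono[OF nz, of "norm w"] by simp
  have h: "norm (?h *v w) \<le> 1 * norm w" for w
    using norm_partial_isometry_le[OF I(1) u v] by simp
  have ht: "norm (transpose ?h *v w) \<le> 1 * norm w" for w
    using norm_partial_isometry_le[OF I(1) v u] by (simp add: transpose_sum_outer del: transpose_matrix_vector)
  have "nuclear_norm (kronecker (transpose ?h) z) \<le> real k"
    unfolding transpose_sum_outer
    by (subst xy) (rule order_trans[OF nuclear_norm_kronecker_le], use prod in \<open>simp add: mult.commute\<close>)
  moreover have "nuclear_norm (kronecker ?h z) \<le> real k"
    by (subst xy) (rule order_trans[OF nuclear_norm_kronecker_le prod])
  moreover have "spectral_norm (kronecker (transpose ?h) z) \<le> 1"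
    using norm_kronecker_mult_vec_le[OF ht zw] by (intro spectral_norm_le) simp_all
  moreover have "spectral_norm (kronecker ?h z) \<le> 1"
    using norm_kronecker_mult_vec_le[OF h zw] by (intro spectral_norm_le) simp_all
  moreover have "nuclear_norm (M_dprime (kronecker (transpose ?h) z)) \<le> sqrt (real k)"
  proof -
    define f :: "real^('p \<times> 'q)" where "f = (\<chi> r. ?h $ fst r $ snd r)"
    define g :: "real^('q \<times> 'p)" where "g = (\<chi> r. z $ snd r $ fst r)"
    \<comment> \<open>The rearrangement separates the entries of the two factors, so it has rank one
      and its nuclear norm is bounded by a product of Frobenius norms.\<close>
    have "M_dprime (kronecker (transpose ?h) z) = outer f g"
      by (simp add: vec_eq_iff M_dprime_kronecker outer_def f_def g_def)
    then have "nuclear_norm (M_dprime (kronecker (transpose ?h) z)) \<le> norm f * norm g"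
      using Sigma_sum_sum_outer_le[of _ "\<lambda>_. f" "\<lambda>_. g" "{()}"]
      by (simp add: nuclear_norm_eq_Sigma_sum)
    also have "norm f = norm ?h"
    proof -
      have "(norm f)\<^sup>2 = (norm ?h)\<^sup>2"
        unfolding norm_square_vec_prod norm_square_matrix by (simp add: f_def)
      then show ?thesis by simp
    qed
    also have "norm g = norm z"
    proof -
      have "(norm g)\<^sup>2 = (norm z)\<^sup>2"
        unfolding norm_square_vec_prod norm_square_matrix by (subst sum.swap) (simp add: g_def)
      then show ?thesis by simp
    qed
    also have "norm ?h * norm z \<le> sqrt (real k) * 1"
    proof (rule mult_mono)
      have "(norm ?h)\<^sup>2 \<le> real k"
        using norm_partial_isometry_square_le[OF I(1) u v] I(2) by linarith
      then show "norm ?h \<le> sqrt (real k)" by (rule real_le_rsqrt)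
    qed (use nz in auto)
    finally show ?thesis by simp
  qed
  ultimately show ?thesis
    by (simp add: Z_star_def M_prime_kronecker)
qed

section \<open>Feasible values and the supremum \<open>Opt_star\<close>\<close>

text \<open>Tests \<open>M\<close> against a signed matrix unit; for a zero entry the left vector is
  0, which \<open>sub_orthonormal\<close> permits.\<close>

lemma abs_entry_le_spectral_norm: "\<bar>M $ i $ j\<bar> \<le> spectral_norm M"
  for M :: "real^'n::finite^'m::finite"
proof -
  define u :: "real^'m" where "u = axis i (sgn (M $ i $ j))"
  have "sub_orthonormal {()} (\<lambda>_. u)" "sub_orthonormal {()} (\<lambda>_. axis j (1::real))"
    by (simp_all add: sub_orthonormal_def u_def norm_axis_1 abs_sgn_eq)
      (simp add: norm_eq_sqrt_inner inner_axis_axis sgn_if)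
  then have "M \<bullet> (\<Sum>_\<in>{()}. outer u (axis j 1)) \<le> Sigma_sum 1 M"
    by (intro inner_partial_isometry_le_Sigma_sum) auto
  then show ?thesis
    by (simp add: spectral_norm_eq_Sigma_sum inner_outer u_def inner_axis' matrix_vector_mult_basis
        column_def sgn_if abs_if split: if_splits)
qed

text \<open>A real supremum dominates its members only if the set is bounded above. Here entries of
  feasible matrices are at most 1 in absolute value.\<close>

lemma objective_le_Opt_star:
  assumes "U \<in> Z_star s" "V \<in> Z_star (2 * s)"
  shows "(\<Sum>i\<in>UNIV. \<Sum>j\<in>UNIV. Theta W $ i $ j * (U $ i $ j + V $ i $ j)) \<le> Opt_star s W"
proof -
  have entry: "\<bar>U $ i $ j\<bar> \<le> 1" if "U \<in> Z_star k" for U :: "real^('a::finite \<times> 'b::finite)^('b \<times> 'a)" and k i j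
    using that abs_entry_le_spectral_norm[of U i j] by (simp add: Z_star_def)
  have "Theta W $ i $ j * (U $ i $ j + V $ i $ j) \<le> \<bar>Theta W $ i $ j\<bar> * 2"
    if "U \<in> Z_star s" "V \<in> Z_star (2 * s)" for U V i j
  proof -
    have "\<bar>U $ i $ j + V $ i $ j\<bar> \<le> 2"
      using entry[OF that(1), of i j] entry[OF that(2), of i j] by linarith
    then have "\<bar>Theta W $ i $ j * (U $ i $ j + V $ i $ j)\<bar> \<le> \<bar>Theta W $ i $ j\<bar> * 2"
      unfolding abs_mult by (intro mult_left_mono) auto
    then show ?thesis by linarith
  qed
  then have "bdd_above ((\<lambda>(U, V). \<Sum>i\<in>UNIV. \<Sum>j\<in>UNIV. Theta W $ i $ j * (U $ i $ j + V $ i $ j))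
      ` (Z_star s \<times> Z_star (2 * s)))"
    by (intro bdd_aboveI[of _ "\<Sum>i\<in>UNIV. \<Sum>j\<in>UNIV. \<bar>Theta W $ i $ j\<bar> * 2"])
      (auto intro!: sum_mono)
  from cSUP_upper[OF _ this, of "(U, V)"] show ?thesis
    using assms by (simp add: Opt_star_def)
qed

lemma Sigma_sum_le_Opt_star:
  fixes W :: "real^'q::finite^'p::finite \<Rightarrow> real^'q^'p"
  assumes W: "linear W"
  shows "Sigma_sum s (W z) + Sigma_sum (2 * s) (W z) \<le> Opt_star s W * nuclear_norm z"
proof -
  have unit: "Sigma_sum s (W z) + Sigma_sum (2 * s) (W z) \<le> Opt_star s W" if z: "nuclear_norm z \<le> 1" for z
  proof -
    obtain I :: "nat set" and u v where I: "finite I" "card I \<le> s" "sub_orthonormal I u" "sub_orthonormal I v"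
      and 1: "Sigma_sum s (W z) = W z \<bullet> (\<Sum>i\<in>I. outer (u i) (v i))"
      by (rule Sigma_sum_attained)
    obtain J :: "nat set" and x y where J: "finite J" "card J \<le> 2 * s" "sub_orthonormal J x" "sub_orthonormal J y"
      and 2: "Sigma_sum (2 * s) (W z) = W z \<bullet> (\<Sum>i\<in>J. outer (x i) (y i))"
      by (rule Sigma_sum_attained)
    \<comment> \<open>The inner product is the trace that defines \<open>Theta\<close>, so Ky Fan
      functionals of \<open>W z\<close> become linear in a Kronecker product.\<close>
    have tr: "W z \<bullet> h = (\<Sum>i\<in>UNIV. \<Sum>j\<in>UNIV. Theta W $ i $ j * kronecker (transpose h) z $ i $ j)" for h
      unfolding Theta_trace[OF W, symmetric]
      by (simp add: trace_def matrix_matrix_mult_def transpose_def inner_vec_def)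
    have "Sigma_sum s (W z) + Sigma_sum (2 * s) (W z) = (\<Sum>i\<in>UNIV. \<Sum>j\<in>UNIV. Theta W $ i $ j *
        (kronecker (transpose (\<Sum>i\<in>I. outer (u i) (v i))) z $ i $ j
          + kronecker (transpose (\<Sum>i\<in>J. outer (x i) (y i))) z $ i $ j))"
      unfolding 1 2 tr by (simp only: distrib_left sum.distrib)
    also have "\<dots> \<le> Opt_star s W"
      by (intro objective_le_Opt_star kronecker_in_Z_star I J z)
    finally show ?thesis .
  qed
  show ?thesis
  \<comment> \<open>Homogeneity reduces to the unit case by division, which leaves
    \<open>z = 0\<close> apart.\<close>
  proof (cases "nuclear_norm z = 0")
    case True
    then have "z = 0" using norm_le_nuclear_norm[of z] by simp
    then show ?thesis
      using True Sigma_sum_scaleR[of 0 _ z] by (simp add: linear_0[OF W])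
  next
    case False
    define t where "t = nuclear_norm z"
    have t: "t > 0" using False norm_le_nuclear_norm[of z] norm_ge_zero[of z] unfolding t_def by linarith
    have "nuclear_norm (z /\<^sub>R t) = 1"
      using t by (simp add: nuclear_norm_eq_Sigma_sum Sigma_sum_scaleR t_def)
    then have "(Sigma_sum s (W z) + Sigma_sum (2 * s) (W z)) / t \<le> Opt_star s W"
      using unit[of "z /\<^sub>R t"] t
      by (simp add: linear_scale[OF W] Sigma_sum_scaleR distrib_left divide_inverse mult.commute)
    then show ?thesis using t by (simp add: divide_le_eq t_def)
  qed
qed

section \<open>The bound\<close>

text \<open>Equivalence of norms in finite dimension: \<open>\<phi>\<close> is Lipschitz for the
  Euclidean norm, so it attains a positive minimum on the sphere. It makes the unit ball of
  \<open>\<phi>\<close> bounded.\<close>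

lemma is_norm_lower_bound:
  fixes \<phi> :: "real^'m::finite \<Rightarrow> real"
  assumes "is_norm \<phi>"
  obtains c where "0 < c" "\<And>x. c * norm x \<le> \<phi> x"
proof -
  have \<phi>: "0 \<le> \<phi> x" "\<phi> x = 0 \<longleftrightarrow> x = 0" "\<phi> (c *\<^sub>R x) = \<bar>c\<bar> * \<phi> x" "\<phi> (x + y) \<le> \<phi> x + \<phi> y" for c x y
    using assms by (auto simp: is_norm_def)
  have \<phi>_sum: "\<phi> (\<Sum>i\<in>I. f i) \<le> (\<Sum>i\<in>I. \<phi> (f i))" if "finite I" for I :: "'m set" and f
    using that
  proof (induction I rule: finite_induct)
    case empty
    then show ?case using \<phi>(2)[of 0] by simp
  next
    case (insert x F)
    then show ?case using \<phi>(4)[of "f x" "sum f F"] by simp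
  qed
  define C where "C = (\<Sum>i\<in>UNIV. \<phi> (axis i 1))"
  have C: "\<phi> x \<le> C * norm x" for x
  proof -
    have "\<phi> x = \<phi> (\<Sum>i\<in>UNIV. x $ i *\<^sub>R axis i 1)"
      using basis_expansion[of x] by (simp add: scalar_mult_eq_scaleR)
    also have "\<dots> \<le> (\<Sum>i\<in>UNIV. \<phi> (x $ i *\<^sub>R axis i 1))" by (rule \<phi>_sum) simp
    also have "\<dots> \<le> (\<Sum>i\<in>UNIV. norm x * \<phi> (axis i 1))"
      unfolding \<phi>(3) by (intro sum_mono mult_right_mono component_le_norm_cart \<phi>)
    finally show ?thesis by (simp add: C_def sum_distrib_left mult.commute)
  qed
  have C0: "0 \<le> C" unfolding C_def by (intro sum_nonneg \<phi>)
  have "C-lipschitz_on UNIV \<phi>"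
  proof (rule lipschitz_onI)
    fix x y
    have "\<phi> x \<le> \<phi> y + \<phi> (x - y)" "\<phi> y \<le> \<phi> x + \<phi> (y - x)"
      using \<phi>(4)[of y "x - y"] \<phi>(4)[of x "y - x"] by simp_all
    then show "dist (\<phi> x) (\<phi> y) \<le> C * dist x y"
      using C[of "x - y"] C[of "y - x"] by (simp add: dist_norm norm_minus_commute abs_le_iff)
  qed (rule C0)
  then have "continuous_on (sphere 0 1) \<phi>"
    by (meson continuous_on_subset lipschitz_on_continuous_on subset_UNIV)
  \<comment> \<open>Any index would do; the point only shows that the sphere is nonempty.\<close>
  moreover have "axis undefined 1 \<in> sphere (0 :: real^'m) 1" by simp
  ultimately obtain e where e: "e \<in> sphere 0 1" "\<And>x. x \<in> sphere 0 1 \<Longrightarrow> \<phi> e \<le> \<phi> x"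
    using continuous_attains_inf[OF compact_sphere, of 0 1 \<phi>] by blast
  show ?thesis
  proof (rule that[of "\<phi> e"])
    show "0 < \<phi> e" using \<phi>(1,2)[of e] e(1) by (metis dist_self le_less mem_sphere zero_neq_one)
    show "\<phi> e * norm x \<le> \<phi> x" for x
    proof (cases "x = 0")
      case False
      then have "\<phi> e \<le> \<phi> (x /\<^sub>R norm x)" by (intro e(2)) simp
      then show ?thesis using False by (simp add: \<phi>(3) field_simps)
    qed (simp add: \<phi>(1))
  qed
qed

text \<open>Splitting \<open>x\<close> into its rows is a rank-one decomposition. The crude constant
  suffices for boundedness.\<close>

lemma Sigma_sum_le_norm:
  fixes x :: "real^'q::finite^'p::finite"
  shows "Sigma_sum k x \<le> real CARD('p) * norm x"
proof -
  have eq: "(\<Sum>i\<in>UNIV. outer (axis i 1) (x $ i)) = x"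
    by (simp add: vec_eq_iff outer_def axis_def if_distrib[of "\<lambda>x. x * _"] cong: if_cong)
  have "Sigma_sum k x \<le> (\<Sum>i\<in>UNIV. norm (axis i 1 :: real^'p) * norm (x $ i))"
    using Sigma_sum_sum_outer_le[of k "\<lambda>i. axis i 1" "\<lambda>i. x $ i" UNIV] unfolding eq .
  also have "\<dots> \<le> (\<Sum>i\<in>(UNIV::'p set). norm x)"
    by (intro sum_mono) (simp add: Finite_Cartesian_Product.norm_nth_le)
  finally show ?thesis by simp
qed

text \<open>The supremum is over a bounded set, since the unit ball of \<open>\<phi>\<close> and the
  map \<open>adjoint H\<close> are bounded; homogeneity extends the bound to all
  \<open>v\<close>.\<close>

lemma Sigma_sum_adjoint_le_beta_of:
  fixes H :: "real^'q::finite^'p::finite \<Rightarrow> real^'m::finite"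
  assumes \<phi>: "is_norm \<phi>" and H: "linear H"
  shows "Sigma_sum s (adjoint H v) + Sigma_sum (2 * s) (adjoint H v) \<le> beta_of \<phi> s H * \<phi> v"
proof -
  let ?F = "\<lambda>v. Sigma_sum s (adjoint H v) + Sigma_sum (2 * s) (adjoint H v)"
  have lin: "linear (adjoint H)" using H by (rule adjoint_linear)
  obtain B where B: "0 < B" "\<And>v. norm (adjoint H v) \<le> B * norm v"
    using linear_bounded_pos[OF lin] by blast
  obtain c where c: "0 < c" "\<And>v. c * norm v \<le> \<phi> v"
    using is_norm_lower_bound[OF \<phi>] by blast
  have "?F v \<le> 2 * (real CARD('p) * (B / c))" if "\<phi> v \<le> 1" for v
  proof -
    have "norm v \<le> 1 / c"
      using c(2)[of v] that c(1) by (simp add: pos_le_divide_eq mult.commute)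
    then have "B * norm v \<le> B * (1 / c)" using B(1) by (intro mult_left_mono) auto
    with B(2)[of v] have "norm (adjoint H v) \<le> B / c" by simp
    then have "real CARD('p) * norm (adjoint H v) \<le> real CARD('p) * (B / c)"
      by (intro mult_left_mono) auto
    then show ?thesis
      using Sigma_sum_le_norm[of s "adjoint H v"] Sigma_sum_le_norm[of "2 * s" "adjoint H v"]
      by linarith
  qed
  then have "bdd_above (?F ` {v. \<phi> v \<le> 1})" by (intro bdd_aboveI) blast
  from cSUP_upper[OF _ this] have unit: "?F v \<le> beta_of \<phi> s H" if "\<phi> v \<le> 1" for v
    using that by (simp add: beta_of_def)
  show ?thesis
  proof (cases "v = 0")
    case True
    then show ?thesis
      using \<phi>[unfolded is_norm_def] Sigma_sum_scaleR[of 0 _ "adjoint H v"]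
      by (metis add_0 linear_0[OF lin] mult_zero_left mult_zero_right order_refl scaleR_zero_left)
  next
    case False
    then have pos: "\<phi> v > 0" using \<phi> by (metis is_norm_def le_less)
    have "\<phi> (v /\<^sub>R \<phi> v) = \<bar>inverse (\<phi> v)\<bar> * \<phi> v" using \<phi> unfolding is_norm_def by blast
    then have "\<phi> (v /\<^sub>R \<phi> v) = 1" using pos by simp
    then have "?F v / \<phi> v \<le> beta_of \<phi> s H"
      using unit[of "v /\<^sub>R \<phi> v"] pos
      by (simp add: linear_scale[OF lin] Sigma_sum_scaleR distrib_left divide_inverse mult.commute)
    then show ?thesis using pos by (simp add: divide_le_eq)
  qed
qed

theorem proposition4p5:
  fixes A :: "real^'q::finite^'p::finite \<Rightarrow> real^'m::finite"
    and \<phi> :: "real^'m \<Rightarrow> real"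
    and s :: nat
    and \<beta>_hat :: "((real^'q^'p) \<Rightarrow>\<^sub>L (real^'m)) \<Rightarrow> real"
    and \<beta> \<gamma> :: real
  assumes "CARD('q) \<le> CARD('p)"
    and "linear A"
    and "is_norm \<phi>"
    and "convex_on UNIV \<beta>_hat"
    and "\<And>H. beta_of \<phi> s (blinfun_apply H) \<le> \<beta>_hat H"
    and "0 \<le> \<beta>" and "0 \<le> \<gamma>"
    and "\<exists>H. Opt_star s (\<lambda>z. z - adjoint (blinfun_apply H) (A z)) \<le> \<gamma> \<and> \<beta>_hat H \<le> \<beta>"
  shows "\<forall>z. Sigma_sum s z + Sigma_sum (2 * s) z \<le> \<beta> * \<phi> (A z) + \<gamma> * nuclear_norm z"
proof
  fix z :: "real^'q^'p"
  obtain H where Opt: "Opt_star s (\<lambda>z. z - adjoint (blinfun_apply H) (A z)) \<le> \<gamma>" and "\<beta>_hat H \<le> \<beta>"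
    using assms(8) by blast
  with assms(5)[of H] have \<beta>: "beta_of \<phi> s (blinfun_apply H) \<le> \<beta>" by linarith
  have H: "linear (blinfun_apply H)"
    by (rule bounded_linear.linear[OF blinfun.bounded_linear_right])
  \<comment> \<open>In the split \<open>z = (z - ?y) + ?y\<close> the first part yields the nuclear
    norm term and the second the term with \<open>\<phi>\<close>.\<close>
  let ?y = "adjoint (blinfun_apply H) (A z)"
  have "linear (\<lambda>z. z - adjoint (blinfun_apply H) (A z))"
    using linear_compose[OF \<open>linear A\<close> adjoint_linear[OF H]]
    by (intro linear_compose_sub linear_ident) (simp add: comp_def)
  from Sigma_sum_le_Opt_star[OF this, of s z]
  have "Sigma_sum s (z - ?y) + Sigma_sum (2 * s) (z - ?y)
      \<le> Opt_star s (\<lambda>z. z - adjoint (blinfun_apply H) (A z)) * nuclear_norm z" .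
  also have "\<dots> \<le> \<gamma> * nuclear_norm z"
    using Opt norm_le_nuclear_norm[of z] norm_ge_zero[of z] by (intro mult_right_mono) linarith+
  finally have 1: "Sigma_sum s (z - ?y) + Sigma_sum (2 * s) (z - ?y) \<le> \<gamma> * nuclear_norm z" .
  have "Sigma_sum s ?y + Sigma_sum (2 * s) ?y \<le> beta_of \<phi> s (blinfun_apply H) * \<phi> (A z)"
    by (rule Sigma_sum_adjoint_le_beta_of[OF assms(3) H])
  also have "\<dots> \<le> \<beta> * \<phi> (A z)"
    using \<beta> assms(3) by (intro mult_right_mono) (auto simp: is_norm_def)
  finally have 2: "Sigma_sum s ?y + Sigma_sum (2 * s) ?y \<le> \<beta> * \<phi> (A z)" .
  have "Sigma_sum k z \<le> Sigma_sum k (z - ?y) + Sigma_sum k ?y" for k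
    using Sigma_sum_add[of k "z - ?y" ?y] by simp
  from this[of s] this[of "2 * s"] 1 2
  show "Sigma_sum s z + Sigma_sum (2 * s) z \<le> \<beta> * \<phi> (A z) + \<gamma> * nuclear_norm z" by linarith
qed

end
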